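(* Fix a player $i$, $\eta>0$, and $\mathbf{x}\in\mathcal{X}$. Suppose the zeroth-order scheme (ZSOL) described in the context is applied to $\min_{\mathbf{v}^i\in\mathcal{X}_i}\phi_{i,\eta}(\mathbf{v}^i,\mathbf{x})$, where $\phi_{i,\eta}(\cdot,\mathbf{x})$ is $c$-strongly convex and $\alpha$-smooth with $\alpha=\tfrac{L_0n_i}{\eta}+c$, and let $\mathbf{v}^{i,*}$ be its minimizer over $\mathcal{X}_i$. Suppose $\zeta_t=\zeta<\tfrac{c}{\alpha^2}$ (with $\zeta>0$), $q=1-2c\zeta+2\zeta^2\alpha^2<1$, and $N_t=\lceil q^{-(t+1)}\rceil$ for every $t$. Then there is a positive scalar $C$ such that $$\mathbb{E}[\|\mathbf{v}^{i,t}-\mathbf{v}^{i,*}\|^2\mid\mathbf{x}]\le C\,q^t\quad\text{for all }t>0.$$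
   Context: $\mathcal{X}_i\subseteq\mathbb{R}^{n_i}$ is closed, convex and bounded, $\mathcal{X}=\prod_j\mathcal{X}_j$. $f_i(\mathbf{v}^i,\mathbf{x}^{-i})=\mathbb{E}[\tilde f_i(\mathbf{v}^i,\mathbf{x}^{-i},\omega)]$ is player $i$'s implicit objective (convex in $\mathbf{v}^i$), where $\tilde f_i(\mathbf{v}^i,\mathbf{x}^{-i},\omega)=\tilde g_i(\mathbf{v}^i,\mathbf{x}^{-i},\omega)+\tilde h_i(\mathbf{v}^i,\mathbf{y}^i(\mathbf{v}^i,\mathbf{x}^{-i},\omega),\omega)$ and $\mathbf{y}^i(\cdot,\omega)$ is the unique solution of a lower-level parametrized variational inequality. With $u^i$ uniform on the unit ball $\mathbb{B}_i\subset\mathbb{R}^{n_i}$, independent of $\omega$, and $c>0$, $\phi_{i,\eta}(\mathbf{v}^i,\mathbf{x})=\mathbb{E}_{u^i}[f_i(\mathbf{v}^i+\eta u^i,\mathbf{x}^{-i})+\tfrac c2\|\mathbf{v}^i+\eta u^i-\mathbf{x}^i\|^2]$; up to an additive constant this equals $f_{i,\eta}(\mathbf{v}^i,\mathbf{x}^{-i})+\tfrac c2\|\mathbf{v}^i-\mathbf{x}^i\|^2$ with $f_{i,\eta}(\mathbf{v}^i,\mathbf{x}^{-i})=\mathbb{E}_{u^i}[f_i(\mathbf{v}^i+\eta u^i,\mathbf{x}^{-i})]$. $L_0$ is the Lipschitz constant on $\mathcal{X}_i+\eta\mathbb{B}_i$ (uniform in $\mathbf{x}\in\mathcal{X}$)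 used in the paper. "$\alpha$-smooth" means differentiable with $\alpha$-Lipschitz gradient. Mini-batch zeroth-order gradient estimator with $N_t$ independent samples $\{(\omega_j,v^{i,j})\}_{j=1}^{N_t}$, $v^{i,j}$ uniform on the unit sphere: $\mathbf{g}_{i,\eta,\phi,N_t}(\mathbf{v}^i,\mathbf{x})=\tfrac1{N_t}\sum_{j=1}^{N_t}\tfrac{n_i}{\eta}\left[\tilde f_i(\mathbf{v}^i+\eta v^{i,j},\mathbf{x}^{-i},\omega_j)+\tfrac c2\|\mathbf{v}^i+\eta v^{i,j}-\mathbf{x}^i\|^2\right]v^{i,j}$. Its error $w_{i,t}=\mathbf{g}_{i,\eta,\phi,N_t}(\mathbf{v}^{i,t},\mathbf{x})-\nabla_{\mathbf{v}^i}\phi_{i,\eta}(\mathbf{v}^{i,t},\mathbf{x})$ satisfies, almost surely, $\mathbb{E}[w_{i,t}\mid\mathbf{v}^{i,t},\mathbf{x}]=0$ and $\mathbb{E}[\|w_{i,t}\|^2\mid\mathbf{v}^{i,t},\mathbf{x}]\le\nu^2/N_t$ for a constant $\nu$. Scheme (ZSOL): given $\mathbf{v}^{i,0}\in\mathcal{X}_i$, $\mathbf{v}^{i,t+1}=\Pi_{\mathcal{X}_i}[\mathbf{v}^{i,t}-\zeta_t\,\mathbf{g}_{i,\eta,\phi,N_t}(\mathbf{v}^{i,t},\mathbf{x})]=\Pi_{\mathcal{X}_i}[\mathbf{v}^{i,t}-\zeta_t(\nabla_{\mathbf{v}^i}\phi_{i,\eta}(\mathbf{v}^{i,t},\mathbf{x})+w_{i,t})]$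 for $t\ge0$, with fresh samples at each step; $\Pi_{\mathcal{X}_i}$ is Euclidean projection. *)

theory Defs
  imports "HOL-Probability.Probability"
begin

text \<open>
  Player \<open>i\<close> has strategies in \<open>real^'n\<close>, so that \<open>n\<^sub>i = CARD('n)\<close>. Only this dimension enters
  the results. The strategies of the rivals live in one common Euclidean space \<open>real^'m\<close>, where the
  set \<open>X j\<close> of rival \<open>j\<close> may be contained in a proper subspace; this accommodates rivals with different
  dimensions \<open>n\<^sub>j \<le> CARD('m)\<close>. A rival profile \<open>x\<^sup>-\<^sup>i\<close> is an element of \<open>Pi\<^sub>E (I - {i}) X\<close>.
\<close>

definition vi_solution :: "'a::real_inner set \<Rightarrow> ('a \<Rightarrow> 'a) \<Rightarrow> 'a \<Rightarrow> bool" where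
  "vi_solution K F y \<longleftrightarrow> y \<in> K \<and> (\<forall>z\<in>K. F y \<bullet> (z - y) \<ge> 0)"

definition strongly_convex_on :: "real \<Rightarrow> 'a::real_inner set \<Rightarrow> ('a \<Rightarrow> real) \<Rightarrow> bool" where
  "strongly_convex_on c S f \<longleftrightarrow> convex S \<and>
     (\<forall>x\<in>S. \<forall>y\<in>S. \<forall>t\<in>{0..1}.
        f ((1 - t) *\<^sub>R x + t *\<^sub>R y)
          \<le> (1 - t) * f x + t * f y - c / 2 * t * (1 - t) * (norm (x - y))\<^sup>2)"

definition grad :: "('a::real_inner \<Rightarrow> real) \<Rightarrow> 'a \<Rightarrow> 'a" where
  "grad f x = (THE D. GDERIV f x :> D)"

text \<open>Differentiability is at the points of \<open>S\<close> in the full space (not relative to \<open>S\<close>), so that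
  the gradient is unique even if \<open>S\<close> has empty interior.\<close>

definition smooth_fun_on :: "real \<Rightarrow> 'a::real_inner set \<Rightarrow> ('a \<Rightarrow> real) \<Rightarrow> bool" where
  "smooth_fun_on \<alpha> S f \<longleftrightarrow> (\<forall>x\<in>S. \<exists>D. GDERIV f x :> D) \<and> \<alpha>-lipschitz_on S (grad f)"

definition uniform_ball :: "'a::euclidean_space measure" where
  "uniform_ball = uniform_measure lborel (cball 0 1)"

text \<open>Normalised surface measure on the unit sphere, obtained as the law of \<open>u / \<parallel>u\<parallel>\<close> for \<open>u\<close>
  uniform on the unit ball (the cone measure, i.e. the rotation invariant probability).\<close>

definition uniform_sphere :: "'a::euclidean_space measure" where
  "uniform_sphere = distr uniform_ball borel sgn"

lemma prob_space_uniform_ball: "prob_space (uniform_ball :: 'a::euclidean_space measure)"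
proof -
  have "emeasure lborel (cball (0::'a) 1) \<noteq> 0"
    using emeasure_lborel_countable[of "{}"] content_cball_pos[of 1 "0::'a"]
    by (metis ennreal_zero_less_divide enn2real_0 less_irrefl measure_def zero_less_one)
  moreover have "emeasure lborel (cball (0::'a) 1) \<noteq> \<infinity>"
    using emeasure_lborel_cball_finite[of "0::'a" 1] by auto
  ultimately show ?thesis
    unfolding uniform_ball_def by (rule prob_space_uniform_measure)
qed

lemma prob_space_uniform_sphere: "prob_space (uniform_sphere :: 'a::euclidean_space measure)"
  unfolding uniform_sphere_def
  by (rule prob_space.prob_space_distr[OF prob_space_uniform_ball])
     (auto simp: uniform_ball_def)

lemma AE_uniform_sphere: "AE s in (uniform_sphere :: 'a::euclidean_space measure). norm s = 1"
proof -
  have *: "sgn \<in> (uniform_ball :: 'a measure) \<rightarrow>\<^sub>M borel"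
    by (auto simp: uniform_ball_def)
  have "AE u in (lborel :: 'a measure). u \<noteq> 0"
    by (rule AE_I'[of "{0}"]) auto
  then have "AE u in (uniform_ball :: 'a measure). u \<noteq> 0"
    unfolding uniform_ball_def by (intro AE_uniform_measureI) auto
  then show ?thesis
    unfolding uniform_sphere_def by (subst AE_distr_iff[OF *]) (auto simp: norm_sgn)
qed

text \<open>The smoothed regularised objective \<open>\<phi>(v, x)\<close>, where \<open>x = (xi, z)\<close> and \<open>z = x\<^sup>-\<^sup>i\<close>.\<close>

definition smoothed_obj ::
  "('a::euclidean_space \<Rightarrow> 'z \<Rightarrow> real) \<Rightarrow> real \<Rightarrow> real \<Rightarrow> 'a \<Rightarrow> 'z \<Rightarrow> 'a \<Rightarrow> real" where
  "smoothed_obj f \<eta> c xi z v =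
     (LINT u|uniform_ball. f (v + \<eta> *\<^sub>R u) z + c / 2 * (norm (v + \<eta> *\<^sub>R u - xi))\<^sup>2)"

text \<open>Estimator of the gradient of \<open>\<phi>(_, x)\<close> from the batch \<open>(\<xi> j, s j)\<close>, \<open>j = 1, \<dots>, N\<close>.\<close>

definition zo_estimator ::
  "('a::euclidean_space \<Rightarrow> 'z \<Rightarrow> 'o \<Rightarrow> real) \<Rightarrow> real \<Rightarrow> real \<Rightarrow> nat \<Rightarrow> (nat \<Rightarrow> 'o) \<Rightarrow> (nat \<Rightarrow> 'a)
     \<Rightarrow> 'a \<Rightarrow> 'z \<Rightarrow> 'a \<Rightarrow> 'a" where
  "zo_estimator ft \<eta> c N \<xi> s xi z v =
     (1 / real N) *\<^sub>R (\<Sum>j=1..N.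
        (real DIM('a) / \<eta> *
           (ft (v + \<eta> *\<^sub>R s j) z (\<xi> j) + c / 2 * (norm (v + \<eta> *\<^sub>R s j - xi))\<^sup>2)) *\<^sub>R s j)"

primrec zsol ::
  "'a::euclidean_space set \<Rightarrow> (nat \<Rightarrow> real) \<Rightarrow> (nat \<Rightarrow> 'a \<Rightarrow> 'a) \<Rightarrow> 'a \<Rightarrow> nat \<Rightarrow> 'a" where
  "zsol S \<zeta> G v0 0 = v0"
| "zsol S \<zeta> G v0 (Suc t) = closest_point S (zsol S \<zeta> G v0 t - \<zeta> t *\<^sub>R G t (zsol S \<zeta> G v0 t))"

definition vec_cond_exp :: "'w measure \<Rightarrow> 'w measure \<Rightarrow> ('w \<Rightarrow> real^'n) \<Rightarrow> 'w \<Rightarrow> real^'n" where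
  "vec_cond_exp M F W \<theta> = (\<chi> k. real_cond_exp M F (\<lambda>\<theta>. W \<theta> $ k) \<theta>)"

end

theory Submission
  imports Defs
begin

text \<open>
  The minimiser is a fixed point of the projected gradient step, the projection is nonexpansive, and
  strong monotonicity and the Lipschitz bound make the exact gradient step a contraction whose squared
  factor is \<open>r = 1 - 2 c \<zeta> + \<zeta>\<^sup>2 \<alpha>\<^sup>2 = q - \<zeta>\<^sup>2 \<alpha>\<^sup>2\<close>. Conditionally on the iterate the error has mean
  zero and second moment at most \<open>\<nu>\<^sup>2 / N t \<le> \<nu>\<^sup>2 q ^ (t + 1)\<close>, so the mean squared distances satisfy
  \<open>a (t + 1) \<le> r * a t + \<zeta>\<^sup>2 \<nu>\<^sup>2 q ^ (t + 1)\<close>. The gap \<open>q - r = \<zeta>\<^sup>2 \<alpha>\<^sup>2\<close> absorbs the second summand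
  as soon as \<open>C \<ge> \<nu>\<^sup>2 q / \<alpha>\<^sup>2\<close>.
\<close>

section \<open>First-order consequences of strong convexity and of minimality\<close>

text \<open>\<open>grad\<close> is a definite description, so it can be used as a derivative only
  once uniqueness is known: the derivative is unique, and a vector is determined by its inner
  products.\<close>

lemma GDERIV_grad:
  assumes "GDERIV f x :> D"
  shows "GDERIV f x :> grad f x"
proof -
  have "D' = D" if "GDERIV f x :> D'" for D'
  proof -
    have "(\<lambda>h. h \<bullet> D') = (\<lambda>h. h \<bullet> D)"
      using that assms unfolding gderiv_def by (rule has_derivative_unique)
    then show ?thesis
      by (metis inner_commute vector_eq_rdot)
  qed
  then show ?thesis
    unfolding grad_def using assms theI[of "gderiv f x" D] by blast
qed

text \<open>The limit is taken from the right because convexity and minimality over a set give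
  information only at the points \<open>x + t *\<^sub>R d\<close> with \<open>t\<close> in (0,1),
  where \<open>d\<close> points into the set.\<close>

lemma GDERIV_directional_limit:
  assumes "GDERIV f x :> D"
  shows "((\<lambda>t. (f (x + t *\<^sub>R d) - f x) / t) \<longlongrightarrow> D \<bullet> d) (at_right 0)"
proof -
  have "((\<lambda>t. f (x + t *\<^sub>R d)) has_derivative (\<lambda>t. (t *\<^sub>R d) \<bullet> D)) (at 0)"
  proof (rule has_derivative_compose[of "\<lambda>t. x + t *\<^sub>R d" "\<lambda>t. t *\<^sub>R d" 0 UNIV f "\<lambda>h. h \<bullet> D"])
    show "((\<lambda>t. x + t *\<^sub>R d) has_derivative (\<lambda>t. t *\<^sub>R d)) (at 0)"
      by (auto intro!: derivative_eq_intros)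
    show "(f has_derivative (\<lambda>h. h \<bullet> D)) (at (x + 0 *\<^sub>R d))"
      using assms by (simp add: gderiv_def)
  qed
  then have "((\<lambda>t. f (x + t *\<^sub>R d)) has_real_derivative D \<bullet> d) (at 0)"
    by (simp add: has_field_derivative_def inner_commute mult.commute[of _ "_ \<bullet> _"])
  then have "((\<lambda>t. (f (x + t *\<^sub>R d) - f x) / t) \<longlongrightarrow> D \<bullet> d) (at 0)"
    by (simp add: has_field_derivative_iff)
  then show ?thesis
    by (rule filterlim_mono) (auto simp: at_le)
qed

lemma eventually_at_right_unit:
  assumes "\<And>t::real. 0 < t \<Longrightarrow> t < 1 \<Longrightarrow> Q t"
  shows "eventually Q (at_right 0)"
  unfolding eventually_at_right_field using assms by (intro exI[of _ 1]) auto

text \<open>Divide the strong convexity inequality on the segment from \<open>x\<close> to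
  \<open>y\<close> by \<open>t\<close> and let \<open>t\<close> tend to 0; the factor
  \<open>1 - t\<close> in the quadratic term tends to 1, which leaves the full
  \<open>c / 2\<close>.\<close>

lemma strongly_convex_on_gradient_inequality:
  assumes "strongly_convex_on c S f" "x \<in> S" "y \<in> S" "GDERIV f x :> D"
  shows "f x + D \<bullet> (y - x) + c / 2 * (norm (x - y))\<^sup>2 \<le> f y"
proof -
  have "((\<lambda>t. f y - f x - c / 2 * (1 - t) * (norm (x - y))\<^sup>2)
          \<longlongrightarrow> f y - f x - c / 2 * (1 - 0) * (norm (x - y))\<^sup>2) (at_right 0)"
    by (intro tendsto_intros)
  moreover have "eventually (\<lambda>t. (f (x + t *\<^sub>R (y - x)) - f x) / t
          \<le> f y - f x - c / 2 * (1 - t) * (norm (x - y))\<^sup>2) (at_right 0)"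
  proof (rule eventually_at_right_unit)
    fix t :: real assume t: "0 < t" "t < 1"
    have "f ((1 - t) *\<^sub>R x + t *\<^sub>R y)
          \<le> (1 - t) * f x + t * f y - c / 2 * t * (1 - t) * (norm (x - y))\<^sup>2"
      using assms t unfolding strongly_convex_on_def by simp
    also have "(1 - t) *\<^sub>R x + t *\<^sub>R y = x + t *\<^sub>R (y - x)"
      by (simp add: algebra_simps)
    finally have "f (x + t *\<^sub>R (y - x)) - f x
          \<le> (f y - f x - c / 2 * (1 - t) * (norm (x - y))\<^sup>2) * t"
      by (simp add: algebra_simps)
    then show "(f (x + t *\<^sub>R (y - x)) - f x) / t
          \<le> f y - f x - c / 2 * (1 - t) * (norm (x - y))\<^sup>2"
      using t by (simp add: pos_divide_le_eq)
  qed
  ultimately have "D \<bullet> (y - x) \<le> f y - f x - c / 2 * (1 - 0) * (norm (x - y))\<^sup>2"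
    by (intro tendsto_le[OF _ _ GDERIV_directional_limit[OF assms(4)]]) auto
  then show ?thesis
    by simp
qed

text \<open>Add the gradient inequalities at \<open>x\<close> and at \<open>y\<close>: the function
  values cancel and the two halves of \<open>c\<close> combine.\<close>

lemma strongly_convex_on_gradient_monotone:
  assumes "strongly_convex_on c S f" "x \<in> S" "y \<in> S" "GDERIV f x :> D" "GDERIV f y :> E"
  shows "c * (norm (x - y))\<^sup>2 \<le> (D - E) \<bullet> (x - y)"
  using strongly_convex_on_gradient_inequality[OF assms(1-4)]
    strongly_convex_on_gradient_inequality[OF assms(1,3,2,5)]
  by (simp add: inner_diff norm_minus_commute)

text \<open>By convexity the segment towards \<open>y\<close> is feasible, so the difference
  quotients at the minimiser are nonnegative, and so is their limit.\<close>

lemma arg_min_variational_inequality: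
  assumes "is_arg_min f (\<lambda>a. a \<in> S) x" "convex S" "y \<in> S" "GDERIV f x :> D"
  shows "0 \<le> (D::'a::real_inner) \<bullet> (y - x)"
proof (rule tendsto_lowerbound[OF GDERIV_directional_limit[OF assms(4)]])
  show "eventually (\<lambda>t. 0 \<le> (f (x + t *\<^sub>R (y - x)) - f x) / t) (at_right 0)"
  proof (rule eventually_at_right_unit)
    fix t :: real assume t: "0 < t" "t < 1"
    have "(1 - t) *\<^sub>R x + t *\<^sub>R y \<in> S"
      using assms t by (intro convexD) (auto simp: is_arg_min_def)
    also have "(1 - t) *\<^sub>R x + t *\<^sub>R y = x + t *\<^sub>R (y - x)"
      by (simp add: algebra_simps)
    finally show "0 \<le> (f (x + t *\<^sub>R (y - x)) - f x) / t"
      using assms(1) t by (simp add: is_arg_min_linorder)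
  qed
qed simp

section \<open>The noisy projected gradient step at a single outcome\<close>

text \<open>For \<open>y\<close> in \<open>S\<close>, the squared distance from
  \<open>x - \<zeta> *\<^sub>R D\<close> to \<open>y\<close> exceeds that to \<open>x\<close> by the
  square of \<open>norm (y - x)\<close> plus \<open>2 * \<zeta> * (D \<bullet> (y - x))\<close>, and
  the latter is nonnegative by the variational inequality.\<close>

lemma arg_min_projected_gradient_fixed_point:
  fixes x :: "'a::euclidean_space"
  assumes "is_arg_min f (\<lambda>a. a \<in> S) x" "convex S" "closed S" "GDERIV f x :> D" "0 \<le> \<zeta>"
  shows "closest_point S (x - \<zeta> *\<^sub>R D) = x"
proof (rule closest_point_unique[symmetric])
  show "\<forall>y\<in>S. dist (x - \<zeta> *\<^sub>R D) x \<le> dist (x - \<zeta> *\<^sub>R D) y"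
  proof
    fix y assume "y \<in> S"
    then have "0 \<le> \<zeta> * (D \<bullet> (y - x))"
      using arg_min_variational_inequality[OF assms(1,2) _ assms(4)] assms(5) by simp
    then have "(norm (\<zeta> *\<^sub>R D))\<^sup>2 \<le> (norm ((y - x) + \<zeta> *\<^sub>R D))\<^sup>2"
      unfolding power2_norm_eq_inner
      using inner_ge_zero[of "y - x"] by (simp add: inner_add inner_commute[of x D] inner_commute[of y D] algebra_simps)
    then have "norm (\<zeta> *\<^sub>R D) \<le> norm ((y - x) + \<zeta> *\<^sub>R D)"
      by (rule power2_le_imp_le) simp
    also have "norm ((y - x) + \<zeta> *\<^sub>R D) = dist (x - \<zeta> *\<^sub>R D) y"
      by (simp add: dist_norm norm_minus_commute algebra_simps)
    finally show "dist (x - \<zeta> *\<^sub>R D) x \<le> dist (x - \<zeta> *\<^sub>R D) y"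
      by (simp add: dist_norm)
  qed
qed (use assms in \<open>auto simp: is_arg_min_def\<close>)

text \<open>Expand the square: strong monotonicity bounds the cross term and the Lipschitz constant
  bounds the quadratic term.\<close>

lemma norm_gradient_step_le:
  assumes "strongly_convex_on c S f" "smooth_fun_on \<alpha> S f" "x \<in> S" "y \<in> S" "0 \<le> \<zeta>"
  shows "(norm (x - y - \<zeta> *\<^sub>R (grad f x - grad f y)))\<^sup>2
    \<le> (1 - 2 * c * \<zeta> + \<zeta>\<^sup>2 * \<alpha>\<^sup>2) * (norm (x - y))\<^sup>2"
proof -
  define e where "e = x - y"
  define d where "d = grad f x - grad f y"
  have G: "GDERIV f x :> grad f x" "GDERIV f y :> grad f y"
    using assms by (auto simp: smooth_fun_on_def intro: GDERIV_grad)
  have 1: "c * (norm e)\<^sup>2 \<le> d \<bullet> e"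
    using strongly_convex_on_gradient_monotone[OF assms(1,3,4) G] by (simp add: e_def d_def)
  have "norm d \<le> \<alpha> * norm e"
    using assms lipschitz_onD[of \<alpha> S "grad f" x y]
    by (simp add: smooth_fun_on_def dist_norm e_def d_def)
  then have "(norm d)\<^sup>2 \<le> (\<alpha> * norm e)\<^sup>2"
    by (intro power_mono) auto
  then have 2: "\<zeta>\<^sup>2 * (norm d)\<^sup>2 \<le> \<zeta>\<^sup>2 * (\<alpha> * norm e)\<^sup>2"
    by (intro mult_left_mono) auto
  have "(norm (e - \<zeta> *\<^sub>R d))\<^sup>2 = (norm e)\<^sup>2 - 2 * \<zeta> * (d \<bullet> e) + \<zeta>\<^sup>2 * (norm d)\<^sup>2"
    unfolding power2_norm_eq_inner
    by (simp add: inner_diff inner_commute power2_eq_square algebra_simps)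
  also have "\<dots> \<le> (norm e)\<^sup>2 - 2 * \<zeta> * (c * (norm e)\<^sup>2) + \<zeta>\<^sup>2 * (\<alpha> * norm e)\<^sup>2"
    using 1 2 assms(5) by (smt (verit) mult_left_mono)
  also have "\<dots> = (1 - 2 * c * \<zeta> + \<zeta>\<^sup>2 * \<alpha>\<^sup>2) * (norm e)\<^sup>2"
    by (simp add: algebra_simps power_mult_distrib)
  finally show ?thesis
    by (simp add: e_def d_def)
qed

text \<open>Since \<open>x\<close> is a fixed point of the exact step, nonexpansiveness compares the
  two steps before projection. The term linear in \<open>e\<close> is kept as an exact inner
  product, not estimated, so that it can vanish in expectation.\<close>

lemma norm_projected_step_le:
  fixes a x :: "'a::euclidean_space"
  assumes "strongly_convex_on c S f" "smooth_fun_on \<alpha> S f" "closed S"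
    and "is_arg_min f (\<lambda>a. a \<in> S) x" "a \<in> S" "0 \<le> \<zeta>"
  shows "(norm (closest_point S (a - \<zeta> *\<^sub>R (grad f a + e)) - x))\<^sup>2
    \<le> (1 - 2 * c * \<zeta> + \<zeta>\<^sup>2 * \<alpha>\<^sup>2) * (norm (a - x))\<^sup>2
      - 2 * \<zeta> * ((a - x - \<zeta> *\<^sub>R (grad f a - grad f x)) \<bullet> e) + \<zeta>\<^sup>2 * (norm e)\<^sup>2"
proof -
  let ?b = "a - x - \<zeta> *\<^sub>R (grad f a - grad f x)"
  have S: "x \<in> S" "convex S" "S \<noteq> {}"
    using assms by (auto simp: is_arg_min_def strongly_convex_on_def)
  have "GDERIV f x :> grad f x"
    using assms S by (auto simp: smooth_fun_on_def intro: GDERIV_grad)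
  then have "closest_point S (x - \<zeta> *\<^sub>R grad f x) = x"
    using assms S by (intro arg_min_projected_gradient_fixed_point) auto
  then have "norm (closest_point S (a - \<zeta> *\<^sub>R (grad f a + e)) - x)
      \<le> norm (a - \<zeta> *\<^sub>R (grad f a + e) - (x - \<zeta> *\<^sub>R grad f x))"
    using closest_point_lipschitz[OF S(2) assms(3) S(3)] by (metis dist_norm)
  also have "a - \<zeta> *\<^sub>R (grad f a + e) - (x - \<zeta> *\<^sub>R grad f x) = ?b - \<zeta> *\<^sub>R e"
    by (simp add: algebra_simps)
  finally have "(norm (closest_point S (a - \<zeta> *\<^sub>R (grad f a + e)) - x))\<^sup>2 \<le> (norm (?b - \<zeta> *\<^sub>R e))\<^sup>2"
    by (rule power_mono) simp
  also have "\<dots> = (norm ?b)\<^sup>2 - 2 * \<zeta> * (?b \<bullet> e) + \<zeta>\<^sup>2 * (norm e)\<^sup>2"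
  proof -
    have "(norm (b - \<zeta> *\<^sub>R e))\<^sup>2 = (norm b)\<^sup>2 - 2 * \<zeta> * (b \<bullet> e) + \<zeta>\<^sup>2 * (norm e)\<^sup>2" for b
      unfolding power2_norm_eq_inner
      by (simp add: inner_diff inner_commute power2_eq_square algebra_simps)
    then show ?thesis .
  qed
  finally show ?thesis
    using norm_gradient_step_le[OF assms(1,2,5) S(1) assms(6)] by linarith
qed

section \<open>Linear recursions with geometrically decaying noise\<close>

text \<open>The last hypothesis rearranges to \<open>r * C + b * q \<le> C * q\<close>, which is
  exactly what the induction step requires.\<close>

lemma geometric_recursion_bound:
  fixes a :: "nat \<Rightarrow> real"
  assumes "\<And>t. a (Suc t) \<le> r * a t + b * q ^ Suc t"
    and "0 \<le> r" "0 \<le> q" "a 0 \<le> C" "b * q \<le> C * (q - r)"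
  shows "a t \<le> C * q ^ t"
proof (induction t)
  case (Suc t)
  have "a (Suc t) \<le> r * (C * q ^ t) + b * q ^ Suc t"
    using assms(1)[of t] mult_left_mono[OF Suc assms(2)] by linarith
  also have "\<dots> = (r * C + b * q) * q ^ t"
    by (simp add: algebra_simps)
  also have "\<dots> \<le> (C * q) * q ^ t"
    using assms by (intro mult_right_mono) (auto simp: algebra_simps)
  finally show ?case
    by (simp add: algebra_simps)
qed (use assms in simp)

section \<open>From conditional moments to integrals\<close>

text \<open>Integrate the conditional bound by the tower property. Working with nonnegative
  integrals makes square integrability a conclusion instead of a premise.\<close>

lemma (in sigma_finite_subalgebra) nn_cond_exp_second_moment:
  assumes [measurable]: "W \<in> borel_measurable M" and "prob_space M" "0 \<le> B"
    and le: "AE \<theta> in M. nn_cond_exp M F (\<lambda>\<theta>. ennreal ((norm (W \<theta>))\<^sup>2)) \<theta> \<le> ennreal B"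
  shows "integrable M (\<lambda>\<theta>. (norm (W \<theta>))\<^sup>2)" "(LINT \<theta>|M. (norm (W \<theta>))\<^sup>2) \<le> B"
proof -
  interpret prob_space M by fact
  have "(\<integral>\<^sup>+ \<theta>. ennreal ((norm (W \<theta>))\<^sup>2) \<partial>M)
      = (\<integral>\<^sup>+ \<theta>. nn_cond_exp M F (\<lambda>\<theta>. ennreal ((norm (W \<theta>))\<^sup>2)) \<theta> \<partial>M)"
    using nn_cond_exp_intg[of "\<lambda>_. 1" "\<lambda>\<theta>. ennreal ((norm (W \<theta>))\<^sup>2)"] by simp
  also have "\<dots> \<le> (\<integral>\<^sup>+ \<theta>. ennreal B \<partial>M)"
    using le by (rule nn_integral_mono_AE)
  finally have *: "(\<integral>\<^sup>+ \<theta>. ennreal ((norm (W \<theta>))\<^sup>2) \<partial>M) \<le> ennreal B"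
    by (simp add: emeasure_space_1)
  then show int: "integrable M (\<lambda>\<theta>. (norm (W \<theta>))\<^sup>2)"
    by (intro integrableI_bounded) (auto simp: le_less_trans)
  have "ennreal (LINT \<theta>|M. (norm (W \<theta>))\<^sup>2) \<le> ennreal B"
    using * by (subst nn_integral_eq_integral[OF int, symmetric]) auto
  then show "(LINT \<theta>|M. (norm (W \<theta>))\<^sup>2) \<le> B"
    using assms(3) by simp
qed

text \<open>An \<open>F\<close>-measurable factor can be moved inside the conditional expectation.
  This is done for each coordinate, as \<open>vec_cond_exp\<close> is defined coordinatewise;
  boundedness of \<open>b\<close> makes the products integrable.\<close>

lemma (in sigma_finite_subalgebra) integral_inner_vec_cond_exp_zero:
  fixes W b :: "'a \<Rightarrow> real^'n"
  assumes W: "integrable M W" and b: "b \<in> borel_measurable F"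
    and bounded: "\<And>\<theta>. \<theta> \<in> space M \<Longrightarrow> norm (b \<theta>) \<le> B"
    and zero: "AE \<theta> in M. vec_cond_exp M F W \<theta> = 0"
  shows "integrable M (\<lambda>\<theta>. b \<theta> \<bullet> W \<theta>)" "(LINT \<theta>|M. b \<theta> \<bullet> W \<theta>) = 0"
proof -
  have bM: "b \<in> borel_measurable M"
    using measurable_from_subalg[OF subalg b] .
  have WM: "W \<in> borel_measurable M"
    using W by auto
  have k: "(\<lambda>\<theta>. x \<theta> $ k) \<in> borel_measurable A" if "x \<in> borel_measurable A"
    for x :: "'a \<Rightarrow> real^'n" and k A
    using that by (simp add: cart_eq_inner_axis)
  have int: "integrable M (\<lambda>\<theta>. b \<theta> $ k * W \<theta> $ k)" for k
  proof (rule Bochner_Integration.integrable_bound)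
    show "integrable M (\<lambda>\<theta>. B * norm (W \<theta>))"
      using W by auto
    show "(\<lambda>\<theta>. b \<theta> $ k * W \<theta> $ k) \<in> borel_measurable M"
      using k[OF bM] k[OF WM] by simp
    show "AE \<theta> in M. norm (b \<theta> $ k * W \<theta> $ k) \<le> norm (B * norm (W \<theta>))"
    proof (rule AE_I2)
      fix \<theta> assume \<theta>: "\<theta> \<in> space M"
      have "\<bar>b \<theta> $ k\<bar> \<le> B"
        using \<theta> bounded component_le_norm_cart order_trans by metis
      then have "\<bar>b \<theta> $ k\<bar> * \<bar>W \<theta> $ k\<bar> \<le> B * norm (W \<theta>)"
        by (intro mult_mono component_le_norm_cart) auto
      \<comment> \<open>\<open>B\<close> is nonnegative because it bounds a norm at the point
        \<open>\<theta>\<close>.\<close>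
      then show "norm (b \<theta> $ k * W \<theta> $ k) \<le> norm (B * norm (W \<theta>))"
        using order_trans[OF norm_ge_zero bounded[OF \<theta>]] by (simp add: abs_mult)
    qed
  qed
  show "integrable M (\<lambda>\<theta>. b \<theta> \<bullet> W \<theta>)"
    using int by (simp add: inner_vec_def)
  have "(LINT \<theta>|M. b \<theta> $ k * W \<theta> $ k) = 0" for k
  proof -
    have "AE \<theta> in M. real_cond_exp M F (\<lambda>\<theta>. W \<theta> $ k) \<theta> = 0"
      using zero by eventually_elim (simp add: vec_cond_exp_def vec_eq_iff)
    then have "(LINT \<theta>|M. b \<theta> $ k * real_cond_exp M F (\<lambda>\<theta>. W \<theta> $ k) \<theta>) = (LINT \<theta>|M. 0)"
      using k[OF bM] by (intro integral_cong_AE) auto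
    then show ?thesis
      using real_cond_exp_intg(2)[OF int k[OF b] k[OF WM]] by simp
  qed
  then show "(LINT \<theta>|M. b \<theta> \<bullet> W \<theta>) = 0"
    using int by (simp add: inner_vec_def)
qed

section \<open>Measurability of the estimator and of functions of the iterate\<close>

text \<open>The sampled objective is measurable only over \<open>D\<close>, so the perturbed points
  must lie in \<open>D\<close> at every outcome before composition is possible.\<close>

lemma measurable_zo_estimator:
  fixes v :: "'w \<Rightarrow> 'a::euclidean_space"
  assumes ft: "(\<lambda>(a, o'). ft a z o') \<in> borel_measurable (restrict_space borel D \<Otimes>\<^sub>M P)"
    and samples: "\<And>j. j \<in> {1..N} \<Longrightarrow> (\<lambda>\<theta>. (\<xi> j \<theta>, s j \<theta>)) \<in> M \<rightarrow>\<^sub>M P \<Otimes>\<^sub>M borel"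
    and v: "v \<in> borel_measurable M"
    and D: "\<And>j \<theta>. j \<in> {1..N} \<Longrightarrow> \<theta> \<in> space M \<Longrightarrow> v \<theta> + \<eta> *\<^sub>R s j \<theta> \<in> D"
  shows "(\<lambda>\<theta>. zo_estimator ft \<eta> c N (\<lambda>j. \<xi> j \<theta>) (\<lambda>j. s j \<theta>) xi z (v \<theta>)) \<in> borel_measurable M"
  unfolding zo_estimator_def
proof (intro borel_measurable_scaleR borel_measurable_sum borel_measurable_times
    borel_measurable_add borel_measurable_const)
  fix j assume j: "j \<in> {1..N}"
  have \<xi>: "\<xi> j \<in> M \<rightarrow>\<^sub>M P"
    using measurable_compose[OF samples[OF j] measurable_fst] by simp
  have s: "s j \<in> borel_measurable M"
    using measurable_compose[OF samples[OF j] measurable_snd] by simp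
  show "s j \<in> borel_measurable M"
    by fact
  show "(\<lambda>\<theta>. (norm (v \<theta> + \<eta> *\<^sub>R s j \<theta> - xi))\<^sup>2) \<in> borel_measurable M"
    using v s by measurable
  have "(\<lambda>\<theta>. v \<theta> + \<eta> *\<^sub>R s j \<theta>) \<in> M \<rightarrow>\<^sub>M restrict_space borel D"
    using v s D[OF j] by (intro measurable_restrict_space2) auto
  from measurable_compose[OF measurable_Pair[OF this \<xi>] ft]
  show "(\<lambda>\<theta>. ft (v \<theta> + \<eta> *\<^sub>R s j \<theta>) z (\<xi> j \<theta>)) \<in> borel_measurable M"
    by simp
qed

text \<open>Serves gradients, which are known to be continuous only on the strategy set, both for
  the full sigma-algebra and for the one generated by the iterate.\<close>

lemma measurable_continuous_on_compose:
  fixes G :: "'a::topological_space \<Rightarrow> 'b::topological_space"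
  assumes "continuous_on S G" "v \<in> borel_measurable M" "\<And>\<theta>. \<theta> \<in> space M \<Longrightarrow> v \<theta> \<in> S"
  shows "(\<lambda>\<theta>. G (v \<theta>)) \<in> borel_measurable M"
proof -
  have "v \<in> M \<rightarrow>\<^sub>M restrict_space borel S"
    using assms(2,3) by (intro measurable_restrict_space2) auto
  from measurable_compose[OF this borel_measurable_continuous_on_restrict[OF assms(1)]]
  show ?thesis .
qed

section \<open>One step in expectation\<close>

text \<open>Integrate the pointwise estimate. The vector multiplying the error is a bounded function
  of \<open>V\<close>, so its inner product with \<open>W\<close> has mean zero and only the second
  moment of \<open>W\<close> remains.\<close>

lemma (in prob_space) expected_projected_step_le:
  fixes V W :: "'a \<Rightarrow> real^'n"
  assumes sc: "strongly_convex_on c S f" and sm: "smooth_fun_on \<alpha> S f"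
    and S: "closed S" "bounded S"
    and x: "is_arg_min f (\<lambda>a. a \<in> S) x" and \<zeta>: "0 \<le> \<zeta>" and B: "0 \<le> B"
    and V: "V \<in> borel_measurable M" "\<And>\<theta>. \<theta> \<in> space M \<Longrightarrow> V \<theta> \<in> S"
    and W: "W \<in> borel_measurable M"
    and mean: "AE \<theta> in M. vec_cond_exp M (vimage_algebra (space M) V borel) W \<theta> = 0"
    and second_moment: "AE \<theta> in M. nn_cond_exp M (vimage_algebra (space M) V borel)
          (\<lambda>\<theta>. ennreal ((norm (W \<theta>))\<^sup>2)) \<theta> \<le> ennreal B"
  shows "(LINT \<theta>|M. (norm (closest_point S (V \<theta> - \<zeta> *\<^sub>R (grad f (V \<theta>) + W \<theta>)) - x))\<^sup>2)
    \<le> (1 - 2 * c * \<zeta> + \<zeta>\<^sup>2 * \<alpha>\<^sup>2) * (LINT \<theta>|M. (norm (V \<theta> - x))\<^sup>2) + \<zeta>\<^sup>2 * B"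
proof -
  let ?F = "vimage_algebra (space M) V borel"
  let ?P = "\<lambda>\<theta>. closest_point S (V \<theta> - \<zeta> *\<^sub>R (grad f (V \<theta>) + W \<theta>))"
  let ?b = "\<lambda>\<theta>. V \<theta> - x - \<zeta> *\<^sub>R (grad f (V \<theta>) - grad f x)"
  define r where "r = 1 - 2 * c * \<zeta> + \<zeta>\<^sup>2 * \<alpha>\<^sup>2"
  have "subalgebra M ?F"
    unfolding subalgebra_def using V(1) by (auto simp: sets_vimage_algebra2 intro: measurable_sets)
  then interpret finite_measure_subalgebra M ?F
    by unfold_locales
  have xS: "x \<in> S" "convex S" "S \<noteq> {}"
    using x sc by (auto simp: is_arg_min_def strongly_convex_on_def)
  have cont: "continuous_on S (grad f)"
    using sm by (auto simp: smooth_fun_on_def intro: lipschitz_on_continuous_on)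
  note [measurable] = V(1) W
  have [measurable]: "(\<lambda>\<theta>. grad f (V \<theta>)) \<in> borel_measurable M"
    using cont V by (rule measurable_continuous_on_compose)
  have [measurable]: "?P \<in> borel_measurable M"
  proof (rule measurable_continuous_on_compose[where S = UNIV and G = "closest_point S"])
    show "continuous_on UNIV (closest_point S)"
      using xS S by (intro continuous_on_closest_point)
  qed auto
  obtain R where "\<forall>a\<in>S. dist x a \<le> R"
    using S(2) unfolding bounded_any_center[of S x] by blast
  then have R: "norm (a - x) \<le> R" if "a \<in> S" for a
    using that by (simp add: dist_norm norm_minus_commute)
  have bounded_int: "integrable M (\<lambda>\<theta>. (norm (U \<theta> - x))\<^sup>2)"
    if "U \<in> borel_measurable M" "\<And>\<theta>. \<theta> \<in> space M \<Longrightarrow> U \<theta> \<in> S" for U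
  proof (rule integrable_const_bound[where B = "R\<^sup>2"])
    show "AE \<theta> in M. norm ((norm (U \<theta> - x))\<^sup>2) \<le> R\<^sup>2"
      using R that by (intro AE_I2) (auto intro!: power_mono)
  qed (use that in measurable)
  have Vint: "integrable M (\<lambda>\<theta>. (norm (V \<theta> - x))\<^sup>2)"
    using V by (rule bounded_int)
  have Pint: "integrable M (\<lambda>\<theta>. (norm (?P \<theta> - x))\<^sup>2)"
    using S xS by (intro bounded_int) (auto intro: closest_point_in_set)
  have prob: "prob_space M"
    by unfold_locales
  note Wsq = nn_cond_exp_second_moment[OF W prob B second_moment]
  have Wint: "integrable M W"
  proof (rule Bochner_Integration.integrable_bound)
    show "integrable M (\<lambda>\<theta>. 1 + (norm (W \<theta>))\<^sup>2)"
      using Wsq(1) by auto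
    \<comment> \<open>On a probability space this turns square integrability of \<open>W\<close>
      into integrability.\<close>
    have "norm a \<le> 1 + (norm a)\<^sup>2" for a :: "real^'n"
      using sum_squares_bound[of 1 "norm a"] by (simp add: power2_eq_square) (smt (verit) norm_ge_zero)
    then show "AE \<theta> in M. norm (W \<theta>) \<le> norm (1 + (norm (W \<theta>))\<^sup>2)"
      by (auto intro!: AE_I2 order_trans[OF _ abs_ge_self])
  qed fact
  \<comment> \<open>Measurability is needed for the sigma-algebra generated by \<open>V\<close>; it
    holds since \<open>?b\<close> is a continuous function of \<open>V\<close> on
    \<open>S\<close>.\<close>
  have bF: "?b \<in> borel_measurable ?F"
  proof (rule measurable_continuous_on_compose[where v = V and S = S
        and G = "\<lambda>a. a - x - \<zeta> *\<^sub>R (grad f a - grad f x)"])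
    show "continuous_on S (\<lambda>a. a - x - \<zeta> *\<^sub>R (grad f a - grad f x))"
      by (intro continuous_intros cont)
    show "V \<in> borel_measurable ?F"
      by (rule measurable_vimage_algebra1) auto
  qed (use V in auto)
  \<comment> \<open>The gradient step estimate and the radius \<open>R\<close> give this bound; the
    absolute value appears because no sign of \<open>r\<close> is available here.\<close>
  have bb: "norm (?b \<theta>) \<le> sqrt (\<bar>r\<bar> * R\<^sup>2)" if "\<theta> \<in> space M" for \<theta>
  proof (rule real_le_rsqrt)
    have "(norm (?b \<theta>))\<^sup>2 \<le> r * (norm (V \<theta> - x))\<^sup>2"
      unfolding r_def using sc sm V(2)[OF that] xS(1) \<zeta> by (rule norm_gradient_step_le)
    also have "\<dots> \<le> \<bar>r\<bar> * R\<^sup>2"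
      using R[OF V(2)[OF that]] by (intro mult_mono power_mono) auto
    finally show "(norm (?b \<theta>))\<^sup>2 \<le> \<bar>r\<bar> * R\<^sup>2" .
  qed
  note cross = integral_inner_vec_cond_exp_zero[OF Wint bF bb mean]
  have "(LINT \<theta>|M. (norm (?P \<theta> - x))\<^sup>2)
      \<le> (LINT \<theta>|M. r * (norm (V \<theta> - x))\<^sup>2 - 2 * \<zeta> * (?b \<theta> \<bullet> W \<theta>) + \<zeta>\<^sup>2 * (norm (W \<theta>))\<^sup>2)"
  proof (rule integral_mono)
    fix \<theta> assume "\<theta> \<in> space M"
    then show "(norm (?P \<theta> - x))\<^sup>2
        \<le> r * (norm (V \<theta> - x))\<^sup>2 - 2 * \<zeta> * (?b \<theta> \<bullet> W \<theta>) + \<zeta>\<^sup>2 * (norm (W \<theta>))\<^sup>2"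
      unfolding r_def using V(2) sc sm S x \<zeta> by (intro norm_projected_step_le)
  qed (use Pint Vint cross Wsq in auto)
  also have "\<dots> = r * (LINT \<theta>|M. (norm (V \<theta> - x))\<^sup>2) + \<zeta>\<^sup>2 * (LINT \<theta>|M. (norm (W \<theta>))\<^sup>2)"
    using Vint cross Wsq by simp
  also have "\<dots> \<le> r * (LINT \<theta>|M. (norm (V \<theta> - x))\<^sup>2) + \<zeta>\<^sup>2 * B"
    using Wsq by (intro add_left_mono mult_left_mono) auto
  finally show ?thesis
    by (simp add: r_def)
qed

section \<open>Linear convergence of the scheme with growing batches\<close>

text \<open>The profile \<open>(xi, z)\<close> is deterministic, so the expectation given the
  profile is a plain integral over \<open>M\<close>.\<close>

theorem lemma12:
  fixes M :: "'w measure" and P :: "'o measure"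
    and I :: "'p set" and i :: 'p
    and X :: "'p \<Rightarrow> (real^'m) set" and Xi :: "(real^'n) set"
    and K :: "real^'n \<Rightarrow> ('p \<Rightarrow> real^'m) \<Rightarrow> 'o \<Rightarrow> (real^'d) set"
    and F :: "real^'n \<Rightarrow> ('p \<Rightarrow> real^'m) \<Rightarrow> 'o \<Rightarrow> real^'d \<Rightarrow> real^'d"
    and y :: "real^'n \<Rightarrow> ('p \<Rightarrow> real^'m) \<Rightarrow> 'o \<Rightarrow> real^'d"
    and g :: "real^'n \<Rightarrow> ('p \<Rightarrow> real^'m) \<Rightarrow> 'o \<Rightarrow> real"
    and h :: "real^'n \<Rightarrow> real^'d \<Rightarrow> 'o \<Rightarrow> real"
    and ft :: "real^'n \<Rightarrow> ('p \<Rightarrow> real^'m) \<Rightarrow> 'o \<Rightarrow> real"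
    and f :: "real^'n \<Rightarrow> ('p \<Rightarrow> real^'m) \<Rightarrow> real"
    and D :: "(real^'n) set"
    and \<phi> :: "real^'n \<Rightarrow> real"
    and \<xi> :: "nat \<Rightarrow> nat \<Rightarrow> 'w \<Rightarrow> 'o" and s :: "nat \<Rightarrow> nat \<Rightarrow> 'w \<Rightarrow> real^'n"
    and v w :: "nat \<Rightarrow> 'w \<Rightarrow> real^'n"
    and xi v0 vstar :: "real^'n" and z :: "'p \<Rightarrow> real^'m"
    and N :: "nat \<Rightarrow> nat"
    and \<eta> c L\<^sub>0 \<alpha> \<nu> \<zeta> q :: real
  assumes spaces: "prob_space M" "prob_space P"
    \<comment> \<open>strategy sets, and the fixed profile \<open>x = (xi, z)\<close>\<close>
    and players: "finite I" "i \<in> I"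
    and rivals: "\<And>j. j \<in> I - {i} \<Longrightarrow> closed (X j) \<and> convex (X j) \<and> bounded (X j)"
    and own: "closed Xi" "convex Xi" "bounded Xi"
    and profile: "xi \<in> Xi" "z \<in> Pi\<^sub>E (I - {i}) X"
    and params: "\<eta> > 0" "c > 0"
    and D: "D = {a + \<eta> *\<^sub>R u | a u. a \<in> Xi \<and> u \<in> cball 0 1}"
    \<comment> \<open>implicit objective\<close>
    and y: "\<And>a b o' y'. a \<in> D \<Longrightarrow> b \<in> Pi\<^sub>E (I - {i}) X \<Longrightarrow> o' \<in> space P \<Longrightarrow>
              vi_solution (K a b o') (F a b o') y' \<longleftrightarrow> y' = y a b o'"
    and ft: "ft = (\<lambda>a b o'. g a b o' + h a (y a b o') o')"
    and ft_measurable: "\<And>b. b \<in> Pi\<^sub>E (I - {i}) X \<Longrightarrow>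
              (\<lambda>(a, o'). ft a b o') \<in> borel_measurable (restrict_space borel D \<Otimes>\<^sub>M P)"
    and ft_integrable: "\<And>a b. a \<in> D \<Longrightarrow> b \<in> Pi\<^sub>E (I - {i}) X \<Longrightarrow> integrable P (ft a b)"
    and f: "f = (\<lambda>a b. LINT o'|P. ft a b o')"
    and f_convex: "\<And>b. b \<in> Pi\<^sub>E (I - {i}) X \<Longrightarrow> convex_on D (\<lambda>a. f a b)"
    and f_Lipschitz: "\<And>b. b \<in> Pi\<^sub>E (I - {i}) X \<Longrightarrow> L\<^sub>0-lipschitz_on D (\<lambda>a. f a b)"
    \<comment> \<open>smoothed regularised objective\<close>
    and \<phi>: "\<phi> = smoothed_obj f \<eta> c xi z"
    and \<alpha>: "\<alpha> = L\<^sub>0 * real CARD('n) / \<eta> + c"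
    and \<phi>_strongly_convex: "strongly_convex_on c Xi \<phi>"
    and \<phi>_smooth: "smooth_fun_on \<alpha> Xi \<phi>"
    and vstar: "is_arg_min \<phi> (\<lambda>a. a \<in> Xi) vstar"
    \<comment> \<open>samples: independent over all steps \<open>t\<close> and batch indices \<open>j\<close>\<close>
    and samples_indep: "prob_space.indep_vars M (\<lambda>_. P \<Otimes>\<^sub>M borel)
              (\<lambda>(t, j) \<theta>. (\<xi> t j \<theta>, s t j \<theta>)) (SIGMA t:UNIV. {1..N t})"
    and samples_law: "\<And>t j. j \<in> {1..N t} \<Longrightarrow>
              distr M (P \<Otimes>\<^sub>M borel) (\<lambda>\<theta>. (\<xi> t j \<theta>, s t j \<theta>)) = P \<Otimes>\<^sub>M uniform_sphere"
    and samples_sphere: "\<And>t j \<theta>. j \<in> {1..N t} \<Longrightarrow> \<theta> \<in> space M \<Longrightarrow> s t j \<theta> \<in> sphere 0 1"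
    \<comment> \<open>the scheme and its error\<close>
    and v0: "v0 \<in> Xi"
    and v: "v = (\<lambda>t \<theta>. zsol Xi (\<lambda>_. \<zeta>)
              (\<lambda>t. zo_estimator ft \<eta> c (N t) (\<lambda>j. \<xi> t j \<theta>) (\<lambda>j. s t j \<theta>) xi z) v0 t)"
    and w: "w = (\<lambda>t \<theta>.
              zo_estimator ft \<eta> c (N t) (\<lambda>j. \<xi> t j \<theta>) (\<lambda>j. s t j \<theta>) xi z (v t \<theta>)
                - grad \<phi> (v t \<theta>))"
    and w_mean: "\<And>t. AE \<theta> in M.
              vec_cond_exp M (vimage_algebra (space M) (v t) borel) (w t) \<theta> = 0"
    and w_second_moment: "\<And>t. AE \<theta> in M.
              nn_cond_exp M (vimage_algebra (space M) (v t) borel)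
                (\<lambda>\<theta>. ennreal ((norm (w t \<theta>))\<^sup>2)) \<theta> \<le> ennreal (\<nu>\<^sup>2 / real (N t))"
    \<comment> \<open>step length and batch sizes\<close>
    and \<zeta>: "\<zeta> > 0" "\<zeta> < c / \<alpha>\<^sup>2"
    and q: "q = 1 - 2 * c * \<zeta> + 2 * \<zeta>\<^sup>2 * \<alpha>\<^sup>2" "q < 1"
    and N: "\<And>t. N t = nat \<lceil>q powi (- int (t + 1))\<rceil>"
  shows "\<exists>C>0. \<forall>t>0. (LINT \<theta>|M. (norm (v t \<theta> - vstar))\<^sup>2) \<le> C * q ^ t"
proof -
  interpret prob_space M by fact
  define a where "a = (\<lambda>t. LINT \<theta>|M. (norm (v t \<theta> - vstar))\<^sup>2)"
  define r where "r = 1 - 2 * c * \<zeta> + \<zeta>\<^sup>2 * \<alpha>\<^sup>2"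
  \<comment> \<open>Nonnegativity is part of \<open>lipschitz_on\<close>; it yields
    \<open>c \<le> \<alpha>\<close>, on which the sign of \<open>r\<close> rests.\<close>
  have "0 \<le> L\<^sub>0"
    using f_Lipschitz[OF profile(2)] by (simp add: lipschitz_on_def)
  then have \<alpha>c: "c \<le> \<alpha>"
    unfolding \<alpha> using params by simp
  then have c\<alpha>: "c\<^sup>2 \<le> \<alpha>\<^sup>2" and \<alpha>_pos: "0 < \<alpha>"
    using params by (auto intro: power_mono)
  have qr: "q = r + \<zeta>\<^sup>2 * \<alpha>\<^sup>2"
    by (simp add: q r_def)
  \<comment> \<open>Completing the square in \<open>r\<close> shows that it is nonnegative.\<close>
  have "0 \<le> (1 - c * \<zeta>)\<^sup>2 + \<zeta>\<^sup>2 * (\<alpha>\<^sup>2 - c\<^sup>2)"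
    using c\<alpha> by simp
  also have "\<dots> = r"
    by (simp add: r_def power2_eq_square algebra_simps)
  finally have r: "0 \<le> r" .
  then have q_pos: "0 < q"
    unfolding qr using \<zeta>(1) \<alpha>_pos by (simp add: add_nonneg_pos)
  \<comment> \<open>Rounding up gives at least \<open>1 / q ^ (t + 1)\<close> samples, so the
    variance decays at the rate \<open>q\<close>.\<close>
  have N_bound: "\<nu>\<^sup>2 / real (N t) \<le> \<nu>\<^sup>2 * q ^ Suc t" for t
  proof -
    have "inverse (q ^ Suc t) = q powi (- int (t + 1))"
      by (simp only: power_int_minus power_int_of_nat Suc_eq_plus1)
    also have "\<dots> \<le> real (N t)"
      unfolding N by (rule real_nat_ceiling_ge)
    finally have le: "inverse (q ^ Suc t) \<le> real (N t)" .
    have "inverse (real (N t)) \<le> inverse (inverse (q ^ Suc t))"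
      using q_pos by (intro le_imp_inverse_le[OF le]) simp
    then have "\<nu>\<^sup>2 * inverse (real (N t)) \<le> \<nu>\<^sup>2 * q ^ Suc t"
      by (intro mult_left_mono) simp_all
    then show ?thesis
      by (simp add: divide_inverse)
  qed
  have v_Suc: "v (Suc t) \<theta> = closest_point Xi (v t \<theta> - \<zeta> *\<^sub>R (grad \<phi> (v t \<theta>) + w t \<theta>))" for t \<theta>
    unfolding w by (simp add: v)
  have v_in: "v t \<theta> \<in> Xi" for t \<theta>
    using v0 own(1) by (cases t) (auto simp: v intro: closest_point_in_set)
  \<comment> \<open>Independence of a family includes the measurability of its members.\<close>
  have sample: "(\<lambda>\<theta>. (\<xi> t j \<theta>, s t j \<theta>)) \<in> M \<rightarrow>\<^sub>M P \<Otimes>\<^sub>M borel" if "j \<in> {1..N t}" for t j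
    using samples_indep that unfolding indep_vars_def by force
  have in_D: "v t \<theta> + \<eta> *\<^sub>R s t j \<theta> \<in> D" if "j \<in> {1..N t}" "\<theta> \<in> space M" for t j \<theta>
    using samples_sphere[OF that] v_in[of t \<theta>] unfolding D by force
  have est: "(\<lambda>\<theta>. zo_estimator ft \<eta> c (N t) (\<lambda>j. \<xi> t j \<theta>) (\<lambda>j. s t j \<theta>) xi z (v t \<theta>))
      \<in> borel_measurable M" if "v t \<in> borel_measurable M" for t
    by (rule measurable_zo_estimator[where ft = ft and z = z and \<xi> = "\<xi> t" and s = "s t"
          and v = "v t", OF ft_measurable[OF profile(2)] sample that in_D])
  \<comment> \<open>By induction, since the estimator at step \<open>t\<close> is evaluated at the
    random point \<open>v t\<close>.\<close>
  have v_meas: "v t \<in> borel_measurable M" for t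
  proof (induction t)
    case 0
    then show ?case by (simp add: v)
  next
    case (Suc t)
    define u where "u = (\<lambda>\<theta>. v t \<theta> - \<zeta> *\<^sub>R
        zo_estimator ft \<eta> c (N t) (\<lambda>j. \<xi> t j \<theta>) (\<lambda>j. s t j \<theta>) xi z (v t \<theta>))"
    have "continuous_on UNIV (closest_point Xi)"
      using own profile by (intro continuous_on_closest_point) auto
    moreover have "u \<in> borel_measurable M"
      unfolding u_def using Suc est[OF Suc] by (intro borel_measurable_diff borel_measurable_scaleR) auto
    ultimately have "(\<lambda>\<theta>. closest_point Xi (u \<theta>)) \<in> borel_measurable M"
      by (rule measurable_continuous_on_compose) simp
    also have "(\<lambda>\<theta>. closest_point Xi (u \<theta>)) = v (Suc t)"
      by (simp add: u_def v)
    finally show ?case .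
  qed
  have "continuous_on Xi (grad \<phi>)"
    using \<phi>_smooth by (auto simp: smooth_fun_on_def intro: lipschitz_on_continuous_on)
  then have "(\<lambda>\<theta>. grad \<phi> (v t \<theta>)) \<in> borel_measurable M" for t
    using v_meas v_in by (rule measurable_continuous_on_compose)
  then have w_meas: "w t \<in> borel_measurable M" for t
    unfolding w by (intro borel_measurable_diff est v_meas)
  have step: "a (Suc t) \<le> r * a t + (\<zeta>\<^sup>2 * \<nu>\<^sup>2) * q ^ Suc t" for t
  proof -
    have "a (Suc t) \<le> r * a t + \<zeta>\<^sup>2 * (\<nu>\<^sup>2 / real (N t))"
      unfolding a_def r_def v_Suc
      using \<phi>_strongly_convex \<phi>_smooth own(1,3) vstar less_imp_le[OF \<zeta>(1)] _ v_meas v_in w_meas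
        w_mean w_second_moment by (rule expected_projected_step_le) simp
    then show ?thesis
      using mult_left_mono[OF N_bound[of t], of "\<zeta>\<^sup>2", OF zero_le_power2]
      by (simp only: mult.assoc)
  qed
  \<comment> \<open>The first summand covers the start of the recursion. The second absorbs the
    noise, because \<open>q - r\<close> equals \<open>\<zeta>\<^sup>2 * \<alpha>\<^sup>2\<close>.
    The last makes \<open>C\<close> positive.\<close>
  define C where "C = a 0 + \<nu>\<^sup>2 * q / \<alpha>\<^sup>2 + 1"
  have a0: "0 \<le> a 0"
    by (simp add: a_def)
  have "(\<zeta>\<^sup>2 * \<nu>\<^sup>2) * q = (\<nu>\<^sup>2 * q / \<alpha>\<^sup>2) * (q - r)"
    using \<alpha>_pos by (simp add: qr)
  also have "\<dots> \<le> C * (q - r)"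
    using a0 by (intro mult_right_mono) (auto simp: C_def qr)
  finally have noise: "(\<zeta>\<^sup>2 * \<nu>\<^sup>2) * q \<le> C * (q - r)" .
  have "a 0 \<le> C"
    using q_pos by (simp add: C_def)
  with step r less_imp_le[OF q_pos] have "a t \<le> C * q ^ t" for t
    using noise by (rule geometric_recursion_bound)
  moreover have "C > 0"
    using a0 q_pos by (simp add: C_def add_nonneg_pos)
  ultimately show ?thesis
    unfolding a_def by blast
qed

end
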